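(* If a graph $G$ is not separation $2$-choosable, then it contains two subgraphs $H_1$ and $H_2$ such that for $i=1,2$: (i) $H_i$ is an (ordered) lollipop or an (ordered) cycle; (ii) the cycle contained in $H_i$ has length at least $4$; (iii) the first vertices of $H_1$ and $H_2$, respectively, are identical; (iv) the second vertices of $H_1$ and $H_2$ are distinct; (v) if $H_1$ or $H_2$ is a cycle, then the second to last vertices of $H_1$ and $H_2$, respectively, are distinct; (vi) if both $H_1$ and $H_2$ are cycles, then the second and second to last vertices of $H_1$ and $H_2$, respectively, are four distinct vertices.
   Context: Graphs are finite and simple. A graph $G$ is separation $k$-choosable if for every assignment of lists $L(v)$ of $k$ colors to the vertices such that $|L(x)\cap L(y)|\le 1$ for every edge $xy$, there is a proper coloring $\varphi$ of $G$ with $\varphi(v)\in L(v)$ for all $v\in V(G)$. Let $P=v_1e_1v_2\dots e_{d-1}v_d$ be a path (with distinct vertices $v_1,\dots,v_d$ and $e_i=v_iv_{i+1}$). The sequence $C=v_1e_1v_2\dots v_de_dv_1$ is an (ordered) cycle if $e_d=v_dv_1$ is an edge. The sequence $D=v_1e_1v_2\dots v_de_dv_j$ is an (ordered) lollipop if $e_d=v_dv_j$ is an edge and $j\in\{2,\dots,d-2\}$; the cycle contained in it is the one on $v_j,\dots,v_d$. In both cases the first vertex is $v_1$, the second vertex is $v_2$, and the second to last vertex (of the sequence) is $v_d$. *)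

theory Defs
  imports "Graph_Theory.Pair_Digraph" "Graph_Theory.Vertex_Walk"
begin

text \<open>
  Finite simple graphs are represented by the locale \<open>pair_graph\<close>: a finite vertex set together with
  a symmetric irreflexive arc relation, an undirected edge \<open>xy\<close> being the pair of arcs
  \<open>(x, y)\<close> and \<open>(y, x)\<close>.
\<close>

text \<open>
  Colours are natural numbers. As only finitely many colours occur in the lists on a finite graph,
  any infinite palette gives the same notion. Lists and colourings are total functions whose values
  outside the vertex set are irrelevant.
\<close>

definition separation_assignment :: "'a pair_pre_digraph \<Rightarrow> nat \<Rightarrow> ('a \<Rightarrow> nat set) \<Rightarrow> bool" where
  "separation_assignment G k L \<longleftrightarrow>
     (\<forall>v\<in>pverts G. finite (L v) \<and> card (L v) = k) \<and>
     (\<forall>x y. (x, y) \<in> parcs G \<longrightarrow> card (L x \<inter> L y) \<le> 1)"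

definition proper_coloring :: "'a pair_pre_digraph \<Rightarrow> ('a \<Rightarrow> nat) \<Rightarrow> bool" where
  "proper_coloring G \<phi> \<longleftrightarrow> (\<forall>x y. (x, y) \<in> parcs G \<longrightarrow> \<phi> x \<noteq> \<phi> y)"

definition separation_choosable :: "'a pair_pre_digraph \<Rightarrow> nat \<Rightarrow> bool" where
  "separation_choosable G k \<longleftrightarrow>
     (\<forall>L. separation_assignment G k L \<longrightarrow>
        (\<exists>\<phi>. proper_coloring G \<phi> \<and> (\<forall>v\<in>pverts G. \<phi> v \<in> L v)))"

text \<open>
  The graph being simple, the sequence \<open>v\<^sub>1 e\<^sub>1 v\<^sub>2 \<dots> v\<^sub>d e\<^sub>d v\<^sub>j\<close> is determined by its vertices; it is
  represented by the list \<open>[v\<^sub>1, \<dots>, v\<^sub>d, v\<^sub>j]\<close> of length \<open>d + 1\<close>, with \<open>j = 1\<close> for cycles. List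
  positions are counted from 0, so \<open>v\<^sub>j\<close> is \<open>vs ! (j - 1)\<close>.

  The bound \<open>3 \<le> length vs\<close> excludes the walk \<open>v\<^sub>1 v\<^sub>2 v\<^sub>1\<close> along a single edge, which is not a cycle
  of a simple graph.
\<close>

definition ordered_cycle :: "'a pair_pre_digraph \<Rightarrow> 'a vwalk \<Rightarrow> bool" where
  "ordered_cycle G H \<longleftrightarrow>
     (\<exists>vs. vpath vs (with_proj G) \<and> 3 \<le> length vs \<and>
        (last vs, hd vs) \<in> parcs G \<and> H = vs @ [hd vs])"

definition ordered_lollipop :: "'a pair_pre_digraph \<Rightarrow> 'a vwalk \<Rightarrow> bool" where
  "ordered_lollipop G H \<longleftrightarrow>
     (\<exists>vs j. vpath vs (with_proj G) \<and> 2 \<le> j \<and> j + 2 \<le> length vs \<and>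
        (last vs, vs ! (j - 1)) \<in> parcs G \<and> H = vs @ [vs ! (j - 1)])"

definition first_vertex :: "'a vwalk \<Rightarrow> 'a" where
  "first_vertex H = hd H"

definition second_vertex :: "'a vwalk \<Rightarrow> 'a" where
  "second_vertex H = H ! 1"

definition second_to_last_vertex :: "'a vwalk \<Rightarrow> 'a" where
  "second_to_last_vertex H = H ! (length H - 2)"

text \<open>
  The suffix \<open>[v\<^sub>j, \<dots>, v\<^sub>d, v\<^sub>j]\<close> starting at the first occurrence of the last vertex. As a closed walk
  its \<open>vwalk_length\<close>, which counts edges, is the length \<open>d - j + 1\<close> of the cycle.
\<close>

definition contained_cycle :: "'a vwalk \<Rightarrow> 'a vwalk" where
  "contained_cycle H = dropWhile (\<lambda>v. v \<noteq> last H) H"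

end

theory Submission
  imports Defs "Graph_Theory.Digraph_Component"
begin

text \<open>
  Colouring from lists of size 2 is an instance of 2-SAT whose literals are the pairs \<open>(v, c)\<close> with
  \<open>c \<in> L v\<close>. If there is no colouring, then at some vertex \<open>v\<close> with \<open>L v = {a, b}\<close> either choice
  forces the other one. In a forcing path without repeated literals from \<open>(v, a)\<close> to \<open>(v, b)\<close>, the
  first repeated vertex closes a cycle on which the first and the last edge carry the same colour.
  This rules out length 3, as two vertices of the triangle would have the same list. The path from
  \<open>(v, a)\<close> leaves \<open>v\<close> along colour \<open>a\<close>, and the one from \<open>(v, b)\<close> along colour \<open>b\<close>, so their second
  vertices differ. If one of the two subgraphs is a cycle and the other one is a lollipop with the
  same second to last vertex, the cycle of the lollipop can be traversed in the opposite direction.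
\<close>

section \<open>Implication digraphs of 2-SAT instances\<close>

text \<open>A maximal closed consistent set works: an undecided literal \<open>l\<close> that does
  not reach \<open>neg l\<close> could be added together with everything reachable from it. By
  \<open>sat\<close>, one of \<open>l\<close> and \<open>neg l\<close> is of this kind.\<close>

lemma ex_closed_consistent_literals:
  fixes r :: "'l rel"
  assumes "finite X" and r: "r \<subseteq> X \<times> X"
    and neg: "\<And>l. l \<in> X \<Longrightarrow> neg l \<in> X" "\<And>l. l \<in> X \<Longrightarrow> neg (neg l) = l"
    and skew: "\<And>l m. (l, m) \<in> r \<Longrightarrow> (neg m, neg l) \<in> r"
    and sat: "\<And>l. l \<in> X \<Longrightarrow> (l, neg l) \<notin> r\<^sup>* \<or> (neg l, l) \<notin> r\<^sup>*"
  shows "\<exists>S\<subseteq>X. r `` S \<subseteq> S \<and> (\<forall>l\<in>X. l \<in> S \<longleftrightarrow> neg l \<notin> S)"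
proof -
  have skew': "(neg m, neg l) \<in> r\<^sup>*" if "(l, m) \<in> r\<^sup>*" for l m
    using that by induction (auto intro: skew converse_rtrancl_into_rtrancl)
  have in_X: "m \<in> X" if "(l, m) \<in> r\<^sup>*" "l \<in> X" for l m
    using that by induction (use r in auto)
  define \<S> where "\<S> = {S. S \<subseteq> X \<and> r `` S \<subseteq> S \<and> (\<forall>l\<in>S. neg l \<notin> S)}"
  have "finite \<S>"
    using \<open>finite X\<close> by (auto simp: \<S>_def intro: finite_subset[of _ "Pow X"])
  moreover have "{} \<in> \<S>" by (auto simp: \<S>_def)
  ultimately obtain S where S: "S \<in> \<S>" and max: "\<And>T. T \<in> \<S> \<Longrightarrow> S \<subseteq> T \<Longrightarrow> T = S"
    by (metis empty_iff finite_has_maximal)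
  have closed: "m \<in> S" if "(l, m) \<in> r\<^sup>*" "l \<in> S" for l m
    using that by induction (use S in \<open>auto simp: \<S>_def\<close>)
  have extend: "l \<in> S \<or> neg l \<in> S" if l: "l \<in> X" "(l, neg l) \<notin> r\<^sup>*" for l
  proof (rule ccontr)
    assume undecided: "\<not> ?thesis"
    define T where "T = S \<union> r\<^sup>* `` {l}"
    have "T \<subseteq> X" "r `` T \<subseteq> T"
      using S l in_X by (auto simp: T_def \<S>_def intro: rtrancl_into_rtrancl)
    moreover have "neg m \<notin> T" if "m \<in> T" for m
    proof
      assume m': "neg m \<in> T"
      have "m \<in> X" using \<open>T \<subseteq> X\<close> that by blast
      \<comment> \<open>By \<open>skew'\<close>, a path from \<open>l\<close> to one of
        \<open>m\<close>, \<open>neg m\<close> yields a path from the other one to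
        \<open>neg l\<close>. The mixed cases then put \<open>neg l\<close> into \<open>S\<close>,
        and the last case makes \<open>neg l\<close> reachable from \<open>l\<close>.\<close>
      consider "m \<in> S" "neg m \<in> S" | "m \<in> S" "(l, neg m) \<in> r\<^sup>*" | "(l, m) \<in> r\<^sup>*" "neg m \<in> S"
        | "(l, m) \<in> r\<^sup>*" "(l, neg m) \<in> r\<^sup>*"
        using \<open>m \<in> T\<close> m' by (auto simp: T_def)
      then show False
      proof cases
        case 1
        then show ?thesis using S by (auto simp: \<S>_def)
      next
        case 2
        then show ?thesis
          using skew'[of l "neg m"] closed undecided neg(2)[OF \<open>m \<in> X\<close>] by auto
      next
        case 3
        then show ?thesis using skew' closed undecided by blast
      next
        case 4
        then have "(m, neg l) \<in> r\<^sup>*"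
          using skew'[of l "neg m"] neg(2)[OF \<open>m \<in> X\<close>] by auto
        with 4 l show ?thesis by (meson rtrancl_trans)
      qed
    qed
    ultimately have "T \<in> \<S>" by (auto simp: \<S>_def)
    then have "T = S" using max by (auto simp: T_def)
    then show False using undecided by (auto simp: T_def)
  qed
  have "l \<in> S \<longleftrightarrow> neg l \<notin> S" if "l \<in> X" for l
  proof -
    have "l \<in> S \<or> neg l \<in> S"
      using extend[of l] extend[of "neg l"] sat[of l] neg that by auto
    then show ?thesis using S by (auto simp: \<S>_def)
  qed
  then show ?thesis using S by (auto simp: \<S>_def)
qed

lemma rtrancl_distinct_listE:
  assumes "(x, y) \<in> r\<^sup>*"
  obtains ps where "ps \<noteq> []" "hd ps = x" "last ps = y" "distinct ps"
    "successively (\<lambda>u v. (u, v) \<in> r) ps"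
proof -
  have "\<exists>ps. ps \<noteq> [] \<and> hd ps = x \<and> last ps = y \<and> distinct ps \<and> successively (\<lambda>u v. (u, v) \<in> r) ps"
    using assms
  proof (induction rule: converse_rtrancl_induct)
    case base
    show ?case by (rule exI[of _ "[y]"]) auto
  next
    case (step x z)
    then obtain ps where ps: "ps \<noteq> []" "hd ps = z" "last ps = y" "distinct ps"
      "successively (\<lambda>u v. (u, v) \<in> r) ps" by blast
    show ?case
    proof (cases "x \<in> set ps")
      case True
      \<comment> \<open>A second visit to \<open>x\<close> is avoided by keeping only the part of
        the path from \<open>x\<close> on.\<close>
      then obtain us vs where "ps = us @ x # vs" by (meson split_list)
      with ps show ?thesis
        by (intro exI[of _ "x # vs"]) (auto simp: successively_append_iff)
    next
      case False
      with ps step show ?thesis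
        by (intro exI[of _ "x # ps"]) (auto simp: successively_Cons)
    qed
  qed
  then show ?thesis using that by blast
qed

section \<open>Forcing between list colours\<close>

text \<open>A literal \<open>(v, c)\<close> reads: \<open>v\<close> gets colour \<open>c\<close>.
  This takes \<open>c\<close> away from the neighbour \<open>w\<close>, and a list of size 2 leaves
  only \<open>d\<close> there.\<close>

definition forces :: "'a pair_pre_digraph \<Rightarrow> ('a \<Rightarrow> nat set) \<Rightarrow> ('a \<times> nat) rel" where
  "forces G L =
     {((v, c), (w, d)). (v, w) \<in> parcs G \<and> c \<in> L v \<and> c \<in> L w \<and> d \<in> L w \<and> d \<noteq> c}"

lemma separation_assignment_eq:
  assumes "separation_assignment G 2 L" "v \<in> pverts G"
    "a \<in> L v" "b \<in> L v" "c \<in> L v" "a \<noteq> c" "b \<noteq> c"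
  shows "a = b"
  using assms by (auto simp: separation_assignment_def card_2_iff)

lemma separation_assignment_arc:
  assumes L: "separation_assignment G k L" "(x, y) \<in> parcs G" and G: "pair_graph G"
    and ab: "a \<in> L x" "a \<in> L y" "b \<in> L x" "b \<in> L y"
  shows "a = b"
proof (rule ccontr)
  assume "a \<noteq> b"
  have "x \<in> pverts G"
    using L(2) G by (meson pair_graph_def pair_digraph_def pair_fin_digraph_def pair_wf_digraph.in_arcsD1)
  then have "finite (L x)" using L by (auto simp: separation_assignment_def)
  then have "card {a, b} \<le> card (L x \<inter> L y)" using ab by (intro card_mono) auto
  moreover have "card (L x \<inter> L y) \<le> 1" using L by (simp add: separation_assignment_def)
  ultimately show False using \<open>a \<noteq> b\<close> by simp
qed

text \<open>By contraposition: if no vertex has two mutually reachable literals, the 2-SAT lemma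
  selects one colour at each vertex, and closure under forcing makes the selection proper.\<close>

lemma not_choosable_forcing_cycle:
  assumes G: "pair_graph G" and L: "separation_assignment G 2 L"
    and bad: "\<nexists>\<phi>. proper_coloring G \<phi> \<and> (\<forall>v\<in>pverts G. \<phi> v \<in> L v)"
  obtains v a b where "v \<in> pverts G" "L v = {a, b}" "a \<noteq> b"
    "((v, a), (v, b)) \<in> (forces G L)\<^sup>*" "((v, b), (v, a)) \<in> (forces G L)\<^sup>*"
proof (rule ccontr)
  note cycle = that
  interpret pair_graph G by fact
  assume "\<not> thesis"
  then have no_cycle: "((v, a), (v, b)) \<notin> (forces G L)\<^sup>* \<or> ((v, b), (v, a)) \<notin> (forces G L)\<^sup>*"
    if "v \<in> pverts G" "L v = {a, b}" "a \<noteq> b" for v a b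
    using that cycle by blast
  define X where "X = Sigma (pverts G) L"
  \<comment> \<open>Negation swaps the two colours of a list; the value of \<open>the_elem\<close>
    is meaningful only for literals in \<open>X\<close>.\<close>
  define neg where "neg = (\<lambda>(v, c). (v, the_elem (L v - {c})))"
  have neg_eq: "neg (v, c) = (v, d)" if "v \<in> pverts G" "c \<in> L v" "d \<in> L v" "c \<noteq> d" for v c d
  proof -
    have "L v - {c} = {d}" using L that by (auto simp: separation_assignment_def card_2_iff)
    then show ?thesis by (simp add: neg_def)
  qed
  have other: "\<exists>d\<in>L v. d \<noteq> c" if "v \<in> pverts G" for v c
    using L that by (auto simp: separation_assignment_def card_2_iff)
  have "\<exists>S\<subseteq>X. forces G L `` S \<subseteq> S \<and> (\<forall>l\<in>X. l \<in> S \<longleftrightarrow> neg l \<notin> S)"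
  proof (rule ex_closed_consistent_literals)
    show "finite X"
      using L pair_finite_verts by (auto simp: X_def separation_assignment_def)
    show "forces G L \<subseteq> X \<times> X"
      by (auto simp: forces_def X_def dest: in_arcsD1 in_arcsD2)
    show "neg l \<in> X" "neg (neg l) = l" if "l \<in> X" for l
    proof -
      obtain v c where l: "l = (v, c)" "v \<in> pverts G" "c \<in> L v"
        using \<open>l \<in> X\<close> by (auto simp: X_def)
      moreover obtain d where "d \<in> L v" "d \<noteq> c" using other l by blast
      ultimately show "neg l \<in> X" "neg (neg l) = l" by (auto simp: neg_eq X_def)
    qed
    \<comment> \<open>The contrapositive: giving \<open>w\<close> the colour \<open>c\<close>
      instead of \<open>d\<close> excludes \<open>c\<close> at \<open>v\<close>, which leaves the
      second colour \<open>e\<close> of \<open>v\<close>.\<close>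
    show "(neg m, neg l) \<in> forces G L" if "(l, m) \<in> forces G L" for l m
    proof -
      obtain v c w d where lm: "l = (v, c)" "m = (w, d)" "(v, w) \<in> parcs G" "c \<in> L v" "c \<in> L w"
        "d \<in> L w" "d \<noteq> c"
        using \<open>(l, m) \<in> forces G L\<close> by (auto simp: forces_def)
      then have vw: "v \<in> pverts G" "w \<in> pverts G" "(w, v) \<in> parcs G"
        using graph_symmetric by (auto dest: in_arcsD1 in_arcsD2)
      moreover obtain e where "e \<in> L v" "e \<noteq> c" using other vw by blast
      moreover have "neg m = (w, c)" using lm vw by (simp add: neg_eq)
      moreover have "neg l = (v, e)" using lm vw \<open>e \<in> L v\<close> \<open>e \<noteq> c\<close> by (simp add: neg_eq)
      ultimately show ?thesis using lm by (auto simp: forces_def)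
    qed
    show "(l, neg l) \<notin> (forces G L)\<^sup>* \<or> (neg l, l) \<notin> (forces G L)\<^sup>*" if "l \<in> X" for l
    proof -
      obtain v c where l: "l = (v, c)" "v \<in> pverts G" "c \<in> L v"
        using \<open>l \<in> X\<close> by (auto simp: X_def)
      moreover obtain d where "d \<in> L v" "d \<noteq> c" using other l by blast
      moreover have "L v = {c, d}"
        using separation_assignment_eq[OF L] l \<open>d \<in> L v\<close> \<open>d \<noteq> c\<close> by blast
      ultimately show ?thesis using no_cycle[of v c d] neg_eq[of v c d] by auto
    qed
  qed
  then obtain S where S: "S \<subseteq> X" "forces G L `` S \<subseteq> S" "\<And>l. l \<in> X \<Longrightarrow> l \<in> S \<longleftrightarrow> neg l \<notin> S"
    by blast
  have "\<exists>c. c \<in> L v \<and> (v, c) \<in> S" if v: "v \<in> pverts G" for v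
  proof -
    obtain c d where "c \<in> L v" "d \<in> L v" "c \<noteq> d" using other[OF v] by metis
    then show ?thesis using S(3)[of "(v, c)"] neg_eq[of v c d] v by (auto simp: X_def)
  qed
  then obtain \<phi> where \<phi>: "\<And>v. v \<in> pverts G \<Longrightarrow> \<phi> v \<in> L v \<and> (v, \<phi> v) \<in> S" by metis
  \<comment> \<open>A monochromatic edge would force the other colour at \<open>y\<close>, putting
    both literals of \<open>y\<close> into \<open>S\<close>.\<close>
  have "\<phi> x \<noteq> \<phi> y" if xy: "(x, y) \<in> parcs G" for x y
  proof
    assume eq: "\<phi> x = \<phi> y"
    have V: "x \<in> pverts G" "y \<in> pverts G" using xy by (auto dest: in_arcsD1 in_arcsD2)
    obtain d where d: "d \<in> L y" "d \<noteq> \<phi> y" using other V by blast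
    then have "((x, \<phi> x), (y, d)) \<in> forces G L"
      using \<phi>[OF V(1)] \<phi>[OF V(2)] xy eq by (auto simp: forces_def)
    then have "(y, d) \<in> S" using S(2) \<phi> V by blast
    moreover have "neg (y, \<phi> y) = (y, d)" using neg_eq \<phi> V d by auto
    ultimately show False using S(3)[of "(y, \<phi> y)"] \<phi> V by (auto simp: X_def)
  qed
  then have "proper_coloring G \<phi>" by (simp add: proper_coloring_def)
  then show False using bad \<phi> by blast
qed

section \<open>Lollipops and cycles\<close>

text \<open>A common form of cycles (\<open>j = 0\<close>) and lollipops (\<open>j > 0\<close>).\<close>

definition lasso :: "'a pair_pre_digraph \<Rightarrow> 'a list \<Rightarrow> nat \<Rightarrow> bool" where
  "lasso G vs j \<longleftrightarrow> vpath vs (with_proj G) \<and> j + 4 \<le> length vs \<and> (last vs, vs ! j) \<in> parcs G"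

lemma set_vwalk_arcs_subset_iff:
  "set (vwalk_arcs p) \<subseteq> A \<longleftrightarrow> successively (\<lambda>x y. (x, y) \<in> A) p"
  by (induction p rule: vwalk_arcs.induct) auto

lemma lasso_iff:
  "lasso G vs j \<longleftrightarrow> set vs \<subseteq> pverts G \<and> successively (\<lambda>x y. (x, y) \<in> parcs G) vs \<and>
     distinct vs \<and> j + 4 \<le> length vs \<and> (last vs, vs ! j) \<in> parcs G"
  by (auto simp: lasso_def vpath_def vwalk_def set_vwalk_arcs_subset_iff)

lemma lasso_ordered:
  assumes "lasso G vs j"
  shows "ordered_lollipop G (vs @ [vs ! j]) \<or> ordered_cycle G (vs @ [vs ! j])"
proof (cases "j = 0")
  case True
  have "vs \<noteq> []" using assms by (auto simp: lasso_def)
  then show ?thesis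
    using assms True by (auto simp: lasso_def ordered_cycle_def hd_conv_nth)
next
  case False
  \<comment> \<open>\<open>lasso\<close> counts positions from 0 and \<open>ordered_lollipop\<close>
    from 1, hence the witness \<open>Suc j\<close>.\<close>
  then have "ordered_lollipop G (vs @ [vs ! j])"
    unfolding ordered_lollipop_def
    using assms by (intro exI[of _ vs] exI[of _ "Suc j"]) (auto simp: lasso_def)
  then show ?thesis ..
qed

text \<open>As \<open>vs\<close> is distinct, the closing vertex determines its position. This turns
  the premises of (v) and (vi) into conditions on indices.\<close>

lemma lasso_ordered_cycleD:
  assumes "lasso G vs j" "ordered_cycle G (vs @ [vs ! j])"
  shows "j = 0"
proof -
  have "vs \<noteq> []" "vs ! j = vs ! 0" "j < length vs" "distinct vs"
    using assms by (auto simp: lasso_def ordered_cycle_def hd_conv_nth vpath_def)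
  then show ?thesis by (metis length_greater_0_conv nth_eq_iff_index_eq)
qed

lemma lasso_contained_cycle:
  assumes "lasso G vs j"
  shows "vwalk_length (contained_cycle (vs @ [vs ! j])) \<ge> 4"
proof -
  have j: "j < length vs" "distinct vs" "j + 4 \<le> length vs"
    using assms by (auto simp: lasso_def vpath_def)
  \<comment> \<open>Distinctness makes position \<open>j\<close> the first occurrence of the final
    vertex, so the remaining closed walk has \<open>length vs - j\<close> edges.\<close>
  have "takeWhile (\<lambda>v. v \<noteq> vs ! j) (vs @ [vs ! j]) = take j (vs @ [vs ! j])"
    using j by (intro takeWhile_eq_take_P_nth) (auto simp: nth_append nth_eq_iff_index_eq)
  then have "contained_cycle (vs @ [vs ! j]) = drop j (vs @ [vs ! j])"
    using j by (simp add: contained_cycle_def dropWhile_eq_drop)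
  then show ?thesis using j by simp
qed

lemma lasso_ends:
  assumes "lasso G vs j"
  shows "first_vertex (vs @ [vs ! j]) = hd vs" "second_vertex (vs @ [vs ! j]) = vs ! 1"
    "second_to_last_vertex (vs @ [vs ! j]) = last vs"
proof -
  have "4 \<le> length vs" using assms by (simp add: lasso_def)
  moreover from this have "vs \<noteq> []" by auto
  ultimately show "first_vertex (vs @ [vs ! j]) = hd vs" "second_vertex (vs @ [vs ! j]) = vs ! 1"
    "second_to_last_vertex (vs @ [vs ! j]) = last vs"
    by (auto simp: first_vertex_def second_vertex_def second_to_last_vertex_def nth_append
        last_conv_nth)
qed

text \<open>The stem up to and including \<open>vs ! j\<close> is kept and the other cycle vertices
  are reversed. For \<open>j = 0\<close> this changes the second vertex as well, hence the condition
  \<open>0 < j\<close>.\<close>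

lemma lasso_reverse:
  assumes G: "pair_graph G" and vs: "lasso G vs j"
  obtains ws where "lasso G ws j" "hd ws = hd vs" "0 < j \<Longrightarrow> ws ! 1 = vs ! 1" "last ws \<noteq> last vs"
proof -
  interpret pair_graph G by fact
  define xs ys where "xs = take (Suc j) vs" and "ys = drop (Suc j) vs"
  have split: "vs = xs @ ys" by (simp add: xs_def ys_def)
  have len: "j + 4 \<le> length vs" using vs by (simp add: lasso_def)
  have "length xs = Suc j" "3 \<le> length ys" using len by (auto simp: xs_def ys_def)
  then have ne: "xs \<noteq> []" "ys \<noteq> []" by auto
  have last: "vs ! j = last xs"
    using split ne \<open>length xs = Suc j\<close> by (simp add: last_conv_nth nth_append)
  have sym: "(x, y) \<in> parcs G \<longleftrightarrow> (y, x) \<in> parcs G" for x y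
    using graph_symmetric by blast
  define ws where "ws = xs @ rev ys"
  have ws_j: "ws ! j = last xs"
    using ne \<open>length xs = Suc j\<close> by (simp add: ws_def last_conv_nth nth_append)
  have "successively (\<lambda>x y. (x, y) \<in> parcs G) (rev ys)"
    using vs unfolding lasso_iff split successively_rev by (subst sym) (simp add: successively_append_iff)
  then have "lasso G ws j"
    using vs ne len last ws_j sym unfolding lasso_iff
    by (auto simp: split ws_def successively_append_iff hd_rev last_rev)
  moreover have "hd ws = hd vs" using ne by (simp add: split ws_def)
  moreover have "ws ! 1 = vs ! 1" if "0 < j"
    using that \<open>length xs = Suc j\<close> by (simp add: split ws_def nth_append)
  moreover have "last ws \<noteq> last vs"
  proof -
    have "distinct ys" using vs by (simp add: lasso_iff split)
    then have "ys ! 0 \<noteq> ys ! (length ys - 1)"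
      using \<open>3 \<le> length ys\<close> ne by (subst nth_eq_iff_index_eq) auto
    then have "hd ys \<noteq> last ys" using ne by (simp add: hd_conv_nth last_conv_nth)
    then show ?thesis using ne by (simp add: split ws_def last_rev)
  qed
  ultimately show ?thesis using that by blast
qed

text \<open>The two literals of \<open>v\<close> make the path repeat a vertex, and the first
  repetition closes the lasso. The colours recorded at its ends later keep the two lassos
  apart.\<close>

lemma lasso_of_forcing_path:
  assumes G: "pair_graph G" and L: "separation_assignment G 2 L"
    and "a \<noteq> b" and path: "((v, a), (v, b)) \<in> (forces G L)\<^sup>*"
  obtains vs j where "lasso G vs j" "hd vs = v" "a \<in> L (vs ! 1)" "j = 0 \<Longrightarrow> a \<in> L (last vs)"
proof -
  interpret pair_graph G by fact
  obtain ps where ps: "ps \<noteq> []" "hd ps = (v, a)" "last ps = (v, b)" "distinct ps"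
    "successively (\<lambda>x y. (x, y) \<in> forces G L) ps"
    using path by (rule rtrancl_distinct_listE)
  define V C where "V = (\<lambda>i. fst (ps ! i))" and "C = (\<lambda>i. snd (ps ! i))"
  have "(v, a) \<in> set ps" "(v, b) \<in> set ps" using ps by (metis hd_in_set, metis last_in_set)
  then have "\<not> inj_on fst (set ps)" using \<open>a \<noteq> b\<close> by (force simp: inj_on_def)
  then have "\<not> distinct (map fst ps)" by (simp add: distinct_map)
  then obtain vs y ys where split: "map fst ps = vs @ y # ys" "y \<in> set vs" "distinct vs"
    by (auto simp: not_distinct_conv_prefix)
  then obtain j where j: "j < length vs" "vs ! j = y" by (auto simp: in_set_conv_nth)
  define m where "m = length vs"
  have len: "m < length ps" using arg_cong[OF split(1), of length] by (simp add: m_def)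
  have V_vs: "vs ! i = V i" if "i < m" for i
    using arg_cong[OF split(1), of "\<lambda>xs. xs ! i"] that len by (simp add: V_def m_def nth_append)
  have "V m = y"
    using arg_cong[OF split(1), of "\<lambda>xs. xs ! m"] len by (simp add: V_def m_def nth_append)
  with j V_vs have V_eq: "V m = V j" by (simp add: m_def)
  have "j < m" using j by (simp add: m_def)
  have step: "(V i, V (Suc i)) \<in> parcs G \<and> C i \<in> L (V i) \<and> C i \<in> L (V (Suc i)) \<and>
      C (Suc i) \<in> L (V (Suc i)) \<and> C (Suc i) \<noteq> C i" if "i < m" for i
    using ps(5) that len unfolding successively_conv_nth forces_def V_def C_def
    by (fastforce simp: case_prod_beta)
  obtain k where k: "m = Suc k" using \<open>j < m\<close> by (cases m) auto
  \<comment> \<open>Two different literals at the same vertex.\<close>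
  have "C m \<noteq> C j"
    using \<open>distinct ps\<close> \<open>j < m\<close> len V_eq
    by (metis C_def V_def less_trans nat_neq_iff nth_eq_iff_index_eq prod.expand)
  have V_in: "V i \<in> pverts G" if "i \<le> m" for i
  proof (cases "i = m")
    case True
    then show ?thesis using step[of k] k in_arcsD2 by blast
  next
    case False
    then show ?thesis using step[of i] that in_arcsD1 by force
  qed
  \<comment> \<open>Both colours lie in the list of the repeated vertex and differ from
    \<open>C m\<close>, so both are its other colour: the first and the last edge of the cycle carry
    the same colour.\<close>
  have C_k: "C k = C j"
    using separation_assignment_eq[OF L V_in[of m], of "C k" "C j" "C m"]
      step[of k] step[of j] k \<open>j < m\<close> \<open>C m \<noteq> C j\<close> V_eq by fastforce
  \<comment> \<open>The cycle has length \<open>m - j\<close>. Length 1 is a loop, and length 2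
    contradicts the change of colour between consecutive literals. In a triangle, the edge avoiding
    \<open>V j\<close> would share both \<open>C j\<close> and \<open>C (Suc j)\<close>.\<close>
  have "j + 4 \<le> m"
  proof (rule ccontr)
    assume "\<not> ?thesis"
    then consider "k = j" | "k = Suc j" | "k = Suc (Suc j)"
      using \<open>j < m\<close> k by linarith
    then show False
    proof cases
      case 1
      then show ?thesis using step[of k] V_eq k no_loops' by auto
    next
      case 2
      then show ?thesis using step[of j] C_k k by auto
    next
      case 3
      then have "C j = C (Suc j)"
        using separation_assignment_arc[OF L _ G, of "V (Suc j)" "V (Suc (Suc j))"]
          step[of j] step[of "Suc j"] step[of k] C_k k by auto
      then show ?thesis using step[of j] k 3 by auto
    qed
  qed
  have "vs \<noteq> []" using split by auto
  then have last: "last vs = V k" using k V_vs by (simp add: last_conv_nth m_def)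
  have hd: "ps ! 0 = (v, a)" using ps by (simp add: hd_conv_nth)
  have "set vs \<subseteq> pverts G"
    using V_in V_vs by (auto simp: in_set_conv_nth m_def)
  moreover have "successively (\<lambda>x y. (x, y) \<in> parcs G) vs"
    using V_vs step by (auto simp: successively_conv_nth m_def)
  ultimately have "lasso G vs j"
    unfolding lasso_iff using split(3) \<open>j + 4 \<le> m\<close> last step[of k] k V_eq V_vs[OF \<open>j < m\<close>]
    by (auto simp: m_def)
  moreover have "hd vs = v"
    using \<open>vs \<noteq> []\<close> V_vs[of 0] hd k by (simp add: hd_conv_nth V_def)
  moreover have "a \<in> L (vs ! 1)"
    using step[of 0] hd V_vs[of 1] \<open>j + 4 \<le> m\<close> by (simp add: C_def)
  \<comment> \<open>In a cycle, the closing edge carries the colour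
    \<open>C k = C 0 = a\<close>.\<close>
  moreover have "a \<in> L (last vs)" if "j = 0"
    using that step[of k] k C_k hd last by (simp add: C_def)
  ultimately show ?thesis using that by blast
qed

section \<open>Pairing two lassos with a common first vertex\<close>

theorem theorem2p4:
  fixes G :: "'a pair_pre_digraph"
  assumes "pair_graph G"
    and "\<not> separation_choosable G 2"
  shows "\<exists>H\<^sub>1 H\<^sub>2.
      (\<forall>H\<in>{H\<^sub>1, H\<^sub>2}. ordered_lollipop G H \<or> ordered_cycle G H) \<and>
      (\<forall>H\<in>{H\<^sub>1, H\<^sub>2}. vwalk_length (contained_cycle H) \<ge> 4) \<and>
      first_vertex H\<^sub>1 = first_vertex H\<^sub>2 \<and>
      second_vertex H\<^sub>1 \<noteq> second_vertex H\<^sub>2 \<and>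
      (ordered_cycle G H\<^sub>1 \<or> ordered_cycle G H\<^sub>2 \<longrightarrow>
         second_to_last_vertex H\<^sub>1 \<noteq> second_to_last_vertex H\<^sub>2) \<and>
      (ordered_cycle G H\<^sub>1 \<and> ordered_cycle G H\<^sub>2 \<longrightarrow>
         distinct [second_vertex H\<^sub>1, second_to_last_vertex H\<^sub>1,
                   second_vertex H\<^sub>2, second_to_last_vertex H\<^sub>2])"
proof -
  interpret pair_graph G by fact
  obtain L where L: "separation_assignment G 2 L"
    and bad: "\<nexists>\<phi>. proper_coloring G \<phi> \<and> (\<forall>v\<in>pverts G. \<phi> v \<in> L v)"
    using assms(2) by (auto simp: separation_choosable_def)
  obtain v a b where v: "L v = {a, b}" "a \<noteq> b"
    "((v, a), (v, b)) \<in> (forces G L)\<^sup>*" "((v, b), (v, a)) \<in> (forces G L)\<^sup>*"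
    using not_choosable_forcing_cycle[OF assms(1) L bad] by metis
  obtain vs i where vs: "lasso G vs i" "hd vs = v" "a \<in> L (vs ! 1)" "i = 0 \<Longrightarrow> a \<in> L (last vs)"
    using lasso_of_forcing_path[OF assms(1) L v(2,3)] by metis
  obtain ws j where ws: "lasso G ws j" "hd ws = v" "b \<in> L (ws ! 1)" "j = 0 \<Longrightarrow> b \<in> L (last ws)"
    using lasso_of_forcing_path[OF assms(1) L v(2)[symmetric] v(4)] by metis
  obtain vs' where vs': "lasso G vs' i" "hd vs' = hd vs" "0 < i \<Longrightarrow> vs' ! 1 = vs ! 1"
    "last vs' \<noteq> last vs"
    using lasso_reverse[OF assms(1) vs(1)] by metis
  obtain ws' where ws': "lasso G ws' j" "hd ws' = hd ws" "0 < j \<Longrightarrow> ws' ! 1 = ws ! 1"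
    "last ws' \<noteq> last ws"
    using lasso_reverse[OF assms(1) ws(1)] by metis
  have first_arc: "(hd xs, xs ! 1) \<in> parcs G" if "lasso G xs k" for xs k
  proof -
    have "xs \<noteq> []" "1 < length xs" using that by (auto simp: lasso_def)
    then show ?thesis using that by (simp add: lasso_iff successively_conv_nth hd_conv_nth)
  qed
  have last_arc: "(hd xs, last xs) \<in> parcs G" if "lasso G xs 0" for xs
  proof -
    have "xs \<noteq> []" using that by (auto simp: lasso_def)
    then show ?thesis using that graph_symmetric by (simp add: lasso_def hd_conv_nth)
  qed
  have second_ne_last: "xs ! 1 \<noteq> last xs" if "lasso G xs k" for xs k
  proof -
    have "xs \<noteq> []" "4 \<le> length xs" "distinct xs" using that by (auto simp: lasso_iff)
    then show ?thesis by (simp add: last_conv_nth nth_eq_iff_index_eq)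
  qed
  \<comment> \<open>If \<open>x = y\<close>, the edge from \<open>v\<close> to \<open>x\<close>
    would have both colours of \<open>v\<close> in common.\<close>
  have separated: "x \<noteq> y" if "(v, x) \<in> parcs G" "a \<in> L x" "b \<in> L y" for x y
    using separation_assignment_arc[OF L that(1) assms(1), of a b] that v by auto
  have "vs ! 1 \<noteq> ws ! 1" using separated first_arc[OF vs(1)] vs ws by blast
  \<comment> \<open>The end neighbours of \<open>v\<close> on \<open>vs\<close> have
    \<open>a\<close> in their lists and those on \<open>ws\<close> have \<open>b\<close>, so
    \<open>separated\<close> handles the mixed pairs.\<close>
  have both_cycles: "distinct [vs ! 1, last vs, ws ! 1, last ws]" if "i = 0" "j = 0"
    using that vs ws separated first_arc[OF vs(1)] first_arc[OF ws(1)] last_arc[of vs] last_arc[of ws]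
      second_ne_last by auto
  obtain xs ys where xs: "lasso G xs i" "hd xs = v" and ys: "lasso G ys j" "hd ys = v"
    and second: "xs ! 1 \<noteq> ys ! 1" and last: "i = 0 \<or> j = 0 \<Longrightarrow> last xs \<noteq> last ys"
    and cycles: "i = 0 \<and> j = 0 \<Longrightarrow> distinct [xs ! 1, last xs, ys ! 1, last ys]"
  \<comment> \<open>If the last vertices agree and at least one lasso is a lollipop, a lollipop is
    reversed: \<open>vs\<close> when \<open>ws\<close> is a cycle, and \<open>ws\<close> otherwise.
    Second vertices stay unchanged.\<close>
  proof (cases "i = 0 \<and> j = 0 \<or> last vs \<noteq> last ws")
    case True
    then show ?thesis
      using that[of vs ws] vs ws \<open>vs ! 1 \<noteq> ws ! 1\<close> both_cycles by auto
  next
    case False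
    show ?thesis
    proof (cases "j = 0")
      case True
      then show ?thesis
        using that[of vs' ws] vs' vs(2) ws \<open>vs ! 1 \<noteq> ws ! 1\<close> False by auto
    next
      case j: False
      then show ?thesis
        using that[of vs ws'] ws' ws(2) vs \<open>vs ! 1 \<noteq> ws ! 1\<close> False by auto
    qed
  qed
  show ?thesis
    using lasso_ordered[OF xs(1)] lasso_ordered[OF ys(1)]
      lasso_contained_cycle[OF xs(1)] lasso_contained_cycle[OF ys(1)]
      lasso_ordered_cycleD[OF xs(1)] lasso_ordered_cycleD[OF ys(1)]
      lasso_ends[OF xs(1)] lasso_ends[OF ys(1)] xs(2) ys(2) second last cycles
    by (intro exI[of _ "xs @ [xs ! i]"] exI[of _ "ys @ [ys ! j]"]) fastforce
qed

end
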